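(* Let $p$ be a prime and $m,n$ positive integers, and set $q=p^m$, $r=p^n$ and $\ell=\max\{p^m(p-1),\,p^n(p-1)\}$. Then there exist mutually orthogonal Sudoku Latin squares $L_1,\ldots,L_\ell$ of order $qr$ of type $(q,r)$, each of which is block-permutational.
   Context: $[n]=\{1,\ldots,n\}$. A Latin square of order $n$ on $[n]$ is an $n\times n$ array with entries in $[n]$ such that every row and every column contains each symbol exactly once. Two Latin squares $L,L'$ of order $n$ are orthogonal if the pairs $(L(a,b),L'(a,b))$, $a,b\in[n]$, are distinct; a family is mutually orthogonal if any two distinct members are orthogonal. For positive integers $q,r$ and $i\in[r]$, $j\in[q]$ put $B_{i,j}=\{(a,b): (i-1)q+1\le a\le iq,\ (j-1)r+1\le b\le jr\}$; these $q\times r$ blocks partition $[qr]^2$. A Latin square of order $qr$ is a Sudoku Latin square of type $(q,r)$ if in each block $B_{i,j}$ every symbol of $[qr]$ occurs exactly once. $L[i,j]$ denotes the $q\times r$ subarray of $L$ on $B_{i,j}$. $L$ is block-permutational if for all $i\in[r],j\in[q]$ there exist permutation matrices $P$ of order $q$ and $Q$ of order $r$ (depending on $i,j$) with $L[i,j]=P^{-1}L[1,1]Q$. *)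

theory Defs
  imports "Jordan_Normal_Form.Matrix" "HOL-Computational_Algebra.Primes"
begin

text \<open>Arrays are matrices with natural number entries. Rows, columns and blocks are numbered from
  \<open>0\<close>, the convention of the matrix library, whereas the symbols of a square of order \<open>n\<close> are
  \<open>1, \<dots>, n\<close>.\<close>

definition latin_square :: "nat \<Rightarrow> nat mat \<Rightarrow> bool" where
  "latin_square n L \<longleftrightarrow> L \<in> carrier_mat n n \<and>
     (\<forall>a<n. \<forall>b<n. L $$ (a, b) \<in> {1..n}) \<and>
     (\<forall>a<n. \<forall>s\<in>{1..n}. \<exists>!b. b < n \<and> L $$ (a, b) = s) \<and>
     (\<forall>b<n. \<forall>s\<in>{1..n}. \<exists>!a. a < n \<and> L $$ (a, b) = s)"

definition orthogonal_squares :: "nat \<Rightarrow> nat mat \<Rightarrow> nat mat \<Rightarrow> bool" where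
  "orthogonal_squares n L L' \<longleftrightarrow>
     inj_on (\<lambda>(a, b). (L $$ (a, b), L' $$ (a, b))) ({..<n} \<times> {..<n})"

definition block :: "nat \<Rightarrow> nat \<Rightarrow> nat mat \<Rightarrow> nat \<Rightarrow> nat \<Rightarrow> nat mat" where
  "block q r L i j = mat q r (\<lambda>(a, b). L $$ (i * q + a, j * r + b))"

definition sudoku_latin_square :: "nat \<Rightarrow> nat \<Rightarrow> nat mat \<Rightarrow> bool" where
  "sudoku_latin_square q r L \<longleftrightarrow> latin_square (q * r) L \<and>
     (\<forall>i<r. \<forall>j<q. \<forall>s\<in>{1..q * r}.
        \<exists>!c. c \<in> {..<q} \<times> {..<r} \<and> block q r L i j $$ c = s)"

definition permutation_matrix :: "nat \<Rightarrow> nat mat \<Rightarrow> bool" where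
  "permutation_matrix n P \<longleftrightarrow> P \<in> carrier_mat n n \<and>
     (\<forall>a<n. \<forall>b<n. P $$ (a, b) \<in> {0, 1}) \<and>
     (\<forall>a<n. \<exists>!b. b < n \<and> P $$ (a, b) = 1) \<and>
     (\<forall>b<n. \<exists>!a. a < n \<and> P $$ (a, b) = 1)"

text \<open>\<open>P'\<close> is the two-sided inverse of \<open>P\<close>; for a permutation matrix it is again a 0-1 matrix, so
  it exists over the semiring of natural numbers.\<close>

definition block_permutational :: "nat \<Rightarrow> nat \<Rightarrow> nat mat \<Rightarrow> bool" where
  "block_permutational q r L \<longleftrightarrow>
     (\<forall>i<r. \<forall>j<q. \<exists>P P' Q.
        permutation_matrix q P \<and> permutation_matrix r Q \<and>
        P' \<in> carrier_mat q q \<and> inverts_mat P P' \<and> inverts_mat P' P \<and>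
        block q r L i j = P' * block q r L 0 0 * Q)"

end

theory Submission
  imports Defs "HOL-Algebra.Algebraic_Closure" "HOL-Algebra.Sylow" "HOL-Number_Theory.Residues"
begin

text \<open>Let \<open>K\<close> be the field with \<open>q r = p ^ (m + n)\<close> elements, with additive subgroups \<open>U\<close> and \<open>V\<close> of
  orders \<open>q\<close> and \<open>r\<close>. Label rows and columns by the elements \<open>x\<close> and \<open>y\<close> of \<open>K\<close> such that the rows of
  a block form a coset of \<open>U\<close> and its columns a coset of \<open>V\<close>, and for \<open>c \<noteq> 0\<close> let \<open>L\<^sub>c (x, y) = c x + y\<close>.
  These squares are Latin and mutually orthogonal. If \<open>c U \<inter> V = 0\<close>, then \<open>K = c U + V\<close>; this is the
  Sudoku property, and it also shows that any two blocks differ by a translation of the rows by an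
  element of \<open>U\<close> and of the columns by an element of \<open>V\<close>. At most \<open>(q - 1) (r - 1) / (p - 1)\<close>
  values of \<open>c\<close> are ratios \<open>v / u\<close> and hence excluded, which leaves at least \<open>l\<close> of them.\<close>

(* HOL-Algebra's notion for monoids would otherwise shadow the prime numbers. *)
hide_const (open) Divisibility.prime

section \<open>Finite fields\<close>

context cring
begin

text \<open>Induction by Pascal's rule: the terms of the next sum split into an
  \<open>x\<close>-part and a \<open>y\<close>-part, and the shifted \<open>y\<close>-sum closes up
  because \<open>n choose Suc n\<close> is zero.\<close>

lemma binomial_expansion:
  assumes [simp]: "x \<in> carrier R" "y \<in> carrier R"
  shows "(x \<oplus> y) [^] (n::nat) = (\<Oplus>k\<in>{..n}. [(n choose k)] \<cdot> (x [^] k \<otimes> y [^] (n - k)))"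
proof (induction n)
  case (Suc n)
  define T where "T n k = [(n choose k)] \<cdot> (x [^] k \<otimes> y [^] (n - k))" for n k :: nat
  have T [simp]: "T n k \<in> carrier R" for n k
    by (simp add: T_def)
  have pascal: "T (Suc n) (Suc k) = x \<otimes> T n k \<oplus> y \<otimes> T n (Suc k)" for k
  proof (cases "k < n")
    case True
    then have "n - k = Suc (n - Suc k)"
      by simp
    then have "x [^] Suc k \<otimes> y [^] (n - k) = y \<otimes> (x [^] Suc k \<otimes> y [^] (n - Suc k))"
      by (simp add: m_ac)
    then show ?thesis
      by (simp add: T_def add_pow_rdistr add.nat_pow_mult [symmetric] m_ac del: nat_pow_Suc)
  next
    case False
    then show ?thesis
      by (cases "k = n") (simp_all add: T_def add_pow_rdistr m_ac binomial_eq_0)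
  qed
  have "(\<Oplus>k\<in>{..Suc n}. T (Suc n) k) = (\<Oplus>k\<in>{..n}. T (Suc n) (Suc k)) \<oplus> T (Suc n) 0"
    by (rule finsum_Suc2) simp
  also have "(\<Oplus>k\<in>{..n}. T (Suc n) (Suc k))
      = (\<Oplus>k\<in>{..n}. x \<otimes> T n k) \<oplus> (\<Oplus>k\<in>{..n}. y \<otimes> T n (Suc k))"
    by (simp add: pascal finsum_addf)
  also have "\<dots> \<oplus> T (Suc n) 0
      = (\<Oplus>k\<in>{..n}. x \<otimes> T n k) \<oplus> ((\<Oplus>k\<in>{..n}. y \<otimes> T n (Suc k)) \<oplus> y \<otimes> T n 0)"
    by (simp add: T_def a_assoc m_ac)
  also have "(\<Oplus>k\<in>{..n}. y \<otimes> T n (Suc k)) \<oplus> y \<otimes> T n 0 = (\<Oplus>k\<in>{..Suc n}. y \<otimes> T n k)"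
    by (rule finsum_Suc2 [symmetric]) simp
  also have "\<dots> = (\<Oplus>k\<in>{..n}. y \<otimes> T n k)"
    by (simp add: finsum_Suc) (simp add: T_def binomial_eq_0)
  also have "(\<Oplus>k\<in>{..n}. x \<otimes> T n k) \<oplus> \<dots> = (x \<oplus> y) \<otimes> (\<Oplus>k\<in>{..n}. T n k)"
    by (simp add: finsum_rdistr l_distr)
  also have "\<dots> = (x \<oplus> y) [^] Suc n"
    using Suc by (simp add: T_def m_comm)
  finally show ?case
    by (simp add: T_def)
qed simp

lemma char_dvd_add_pow:
  assumes "[p] \<cdot> \<one> = \<zero>" "p dvd k" "x \<in> carrier R"
  shows "[(k::nat)] \<cdot> x = \<zero>"
proof -
  obtain j where j: "k = p * j"
    using assms(2) by blast
  have "[k] \<cdot> x = [k] \<cdot> \<one> \<otimes> x"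
    using assms(3) by (simp add: add_pow_ldistr)
  also have "[k] \<cdot> \<one> = [j] \<cdot> ([p] \<cdot> \<one>)"
    by (simp add: j add.nat_pow_pow)
  finally show ?thesis
    using assms by simp
qed

text \<open>For \<open>0 < i < p\<close> the coefficient \<open>p choose i\<close> is divisible by
  \<open>p\<close>, so only the outer terms of the \<open>p\<close>-th power survive; the exponent
  \<open>p ^ n\<close> follows by iteration.\<close>

lemma frobenius_add:
  assumes p: "prime p" and char: "[p] \<cdot> \<one> = \<zero>" and [simp]: "x \<in> carrier R" "y \<in> carrier R"
  shows "(x \<oplus> y) [^] (p ^ n :: nat) = x [^] (p ^ n) \<oplus> y [^] (p ^ n)"
proof (induction n)
  case (Suc n)
  have step: "(a \<oplus> b) [^] p = a [^] p \<oplus> b [^] p" if [simp]: "a \<in> carrier R" "b \<in> carrier R" for a b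
  proof -
    \<comment> \<open>Writing \<open>p = k + 2\<close> lets the terms \<open>i = 0\<close> and
      \<open>i = p\<close> be split off, leaving exactly the inner ones, indexed by
      \<open>Suc i\<close> with \<open>i \<le> k\<close>.\<close>
    obtain k where k: "p = Suc (Suc k)"
      using prime_ge_2_nat [OF p] by (metis Suc_1 add_2_eq_Suc le_Suc_ex)
    let ?t = "\<lambda>i. [(p choose i)] \<cdot> (a [^] i \<otimes> b [^] (p - i))"
    have "?t (Suc i) = \<zero>" if "i \<le> k" for i
      using that p k by (intro char_dvd_add_pow [OF char] dvd_choose_prime) auto
    then have "(\<Oplus>i\<in>{..k}. ?t (Suc i)) = (\<Oplus>i\<in>{..k}. \<zero>)"
      by (intro finsum_cong) auto
    then have "(\<Oplus>i\<in>{..k}. ?t (Suc i)) = \<zero>"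
      by simp
    moreover have "(\<Oplus>i\<in>{..p}. ?t i) = ?t (Suc (Suc k)) \<oplus> ((\<Oplus>i\<in>{..k}. ?t (Suc i)) \<oplus> ?t 0)"
      unfolding k by (subst finsum_Suc, simp, subst finsum_Suc2) simp_all
    ultimately show ?thesis
      unfolding binomial_expansion [OF that] by (simp add: k)
  qed
  have "(x \<oplus> y) [^] (p ^ Suc n) = ((x \<oplus> y) [^] (p ^ n)) [^] p"
    by (simp add: nat_pow_pow mult.commute)
  also have "\<dots> = (x [^] (p ^ n)) [^] p \<oplus> (y [^] (p ^ n)) [^] p"
    by (simp add: Suc step)
  finally show ?case
    by (simp add: nat_pow_pow mult.commute)
qed simp

end

text \<open>Homomorphisms commute with multiples of one. This carries the characteristic over to
  algebraic closures and polynomial rings.\<close>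

lemma (in ring_hom_ring) char_image:
  assumes "[p] \<cdot>\<^bsub>R\<^esub> \<one>\<^bsub>R\<^esub> = \<zero>\<^bsub>R\<^esub>"
  shows "[(p::nat)] \<cdot>\<^bsub>S\<^esub> \<one>\<^bsub>S\<^esub> = \<zero>\<^bsub>S\<^esub>"
proof -
  have "h ([n] \<cdot>\<^bsub>R\<^esub> \<one>\<^bsub>R\<^esub>) = [n] \<cdot>\<^bsub>S\<^esub> \<one>\<^bsub>S\<^esub>" for n :: nat
    by (induction n) simp_all
  then show ?thesis
    using assms by (metis hom_zero)
qed

section \<open>Fixed points of the Frobenius map as roots of \<open>X ^ q - X\<close>\<close>

context algebraically_closed
begin

text \<open>With \<open>Y = X - a\<close>, the freshman's dream gives \<open>X ^ q - X = Y ^ q - Y\<close>, so a double root at \<open>a\<close>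
  would make \<open>Y\<^sup>2\<close> divide \<open>Y\<close>.\<close>
lemma alg_mult_frobenius_le_1:
  fixes p q n :: nat
  assumes p: "prime p" and char: "[p] \<cdot> \<one> = \<zero>" and q: "q = p ^ n" "2 \<le> q"
    and P: "P = X [^]\<^bsub>poly_ring L\<^esub> q \<ominus>\<^bsub>poly_ring L\<^esub> X" and a: "a \<in> carrier L" "a [^] q = a"
  shows "alg_mult P a \<le> 1"
proof (rule ccontr)
  interpret UP: domain "poly_ring L"
    by (rule univ_poly_is_domain [OF carrier_is_subring])
  have "poly_of_const \<in> ring_hom L (poly_ring L)"
    using canonical_embedding_is_hom [OF carrier_is_subring] by simp
  then interpret const: ring_hom_ring L "poly_ring L" poly_of_const
    by (intro ring_hom_ringI2 ring_axioms UP.ring_axioms)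
  define A where "A = poly_of_const a"
  define Y where "Y = [\<one>, \<ominus> a]"
  have A: "A \<in> carrier (poly_ring L)" "A [^]\<^bsub>poly_ring L\<^esub> q = A"
    using a const.hom_nat_pow [of a q] by (simp_all add: A_def)
  have Y: "Y \<in> carrier (poly_ring L)"
    using a by (auto simp: Y_def univ_poly_carrier [symmetric] polynomial_def)
  have X: "X \<in> carrier (poly_ring L)"
    by (rule var_closed [OF carrier_is_subring])
  have XYA: "X = Y \<oplus>\<^bsub>poly_ring L\<^esub> A"
    using a by (auto simp: Y_def A_def var_def poly_of_const_def univ_poly_add poly_add.simps l_neg)
  have "X [^]\<^bsub>poly_ring L\<^esub> q = Y [^]\<^bsub>poly_ring L\<^esub> q \<oplus>\<^bsub>poly_ring L\<^esub> A"
    using UP.frobenius_add [OF p const.char_image [OF char] Y A(1), of n] A(2)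
    unfolding XYA q by simp
  \<comment> \<open>Subtracting \<open>X = Y + A\<close> from \<open>X ^ q = Y ^ q + A\<close>
    cancels the constant \<open>A\<close>.\<close>
  moreover have cancel: "(Z \<oplus>\<^bsub>poly_ring L\<^esub> C) \<ominus>\<^bsub>poly_ring L\<^esub> (W \<oplus>\<^bsub>poly_ring L\<^esub> C) = Z \<ominus>\<^bsub>poly_ring L\<^esub> W"
    if "Z \<in> carrier (poly_ring L)" "C \<in> carrier (poly_ring L)" "W \<in> carrier (poly_ring L)" for Z C W
    using that by algebra
  ultimately have PY: "P = Y [^]\<^bsub>poly_ring L\<^esub> q \<ominus>\<^bsub>poly_ring L\<^esub> Y"
    using cancel [OF UP.nat_pow_closed [OF Y, of q] A(1) Y] by (simp add: P XYA)
  assume "\<not> alg_mult P a \<le> 1"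
  then have "(Y [^]\<^bsub>poly_ring L\<^esub> (2::nat)) pdivides P"
    unfolding Y_def by (intro le_alg_mult_imp_pdivides a) (use X in \<open>auto simp: P\<close>)
  then obtain B where B: "B \<in> carrier (poly_ring L)"
      "P = Y [^]\<^bsub>poly_ring L\<^esub> (2::nat) \<otimes>\<^bsub>poly_ring L\<^esub> B"
    by (auto simp: pdivides_def factor_def)
  \<comment> \<open>As \<open>2 \<le> q\<close>, the square of \<open>Y\<close> divides
    \<open>Y ^ q\<close>; it also divides \<open>P\<close>, hence \<open>Y = Y ^ q - P\<close>,
    which the degrees forbid.\<close>
  have "Y [^]\<^bsub>poly_ring L\<^esub> q = Y [^]\<^bsub>poly_ring L\<^esub> (2::nat) \<otimes>\<^bsub>poly_ring L\<^esub> Y [^]\<^bsub>poly_ring L\<^esub> (q - 2)"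
    using UP.nat_pow_mult [OF Y, of 2 "q - 2"] q(2) by (metis le_add_diff_inverse)
  moreover have "Y = Y [^]\<^bsub>poly_ring L\<^esub> q \<ominus>\<^bsub>poly_ring L\<^esub> P"
    unfolding PY using Y UP.nat_pow_closed [OF Y, of q] by algebra
  ultimately have "Y = Y [^]\<^bsub>poly_ring L\<^esub> (2::nat) \<otimes>\<^bsub>poly_ring L\<^esub>
      (Y [^]\<^bsub>poly_ring L\<^esub> (q - 2) \<ominus>\<^bsub>poly_ring L\<^esub> B)"
    using B Y by (simp add: UP.minus_eq UP.r_distr UP.r_minus)
  then have "(Y [^]\<^bsub>poly_ring L\<^esub> (2::nat)) pdivides Y"
    unfolding pdivides_def factor_def using B Y by blast
  then have "degree (Y [^]\<^bsub>poly_ring L\<^esub> (2::nat)) \<le> degree Y"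
    using Y by (intro pdivides_imp_degree_le [OF carrier_is_subring]) (auto simp: Y_def)
  then show False
    unfolding polynomial_pow_degree [OF Y] by (simp add: Y_def)
qed

text \<open>The fixed points are the roots of \<open>X ^ q - X\<close>. Over an algebraically closed
  field this polynomial has \<open>q\<close> roots counted with multiplicity, and all of them are
  simple.\<close>

lemma card_frobenius_fixed:
  fixes p q n :: nat
  assumes p: "prime p" and char: "[p] \<cdot> \<one> = \<zero>" and q: "q = p ^ n" "2 \<le> q"
  shows "card {x \<in> carrier L. x [^] q = x} = q"
proof -
  interpret UP: domain "poly_ring L"
    by (rule univ_poly_is_domain [OF carrier_is_subring])
  define P where "P = X [^]\<^bsub>poly_ring L\<^esub> q \<ominus>\<^bsub>poly_ring L\<^esub> X"
  have X: "X \<in> carrier (poly_ring L)"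
    by (rule var_closed [OF carrier_is_subring])
  then have P: "P \<in> carrier (poly_ring L)"
    by (simp add: P_def)
  have "degree (X [^]\<^bsub>poly_ring L\<^esub> q) = q"
    using polynomial_pow_degree [OF X, of q] by (simp add: var_def)
  moreover have "degree (\<ominus>\<^bsub>poly_ring L\<^esub> X) = 1"
    using univ_poly_a_inv_degree [OF carrier_is_subring X] by (simp add: var_def)
  ultimately have deg: "degree P = q"
    unfolding P_def a_minus_def univ_poly_add using q(2) X
    by (subst poly_add_degree_eq [OF carrier_is_subring]) (auto simp: univ_poly_carrier)
  then have [simp]: "P \<noteq> []"
    using q(2) by auto
  have root: "is_root P x \<longleftrightarrow> x \<in> carrier L \<and> x [^] q = x" for x
  proof (cases "x \<in> carrier L")
    case x: True
    interpret eval: ring_hom_ring "poly_ring L" L "\<lambda>p. eval p x"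
      by (rule eval_ring_hom [OF carrier_is_subring x])
    have "eval P x = x [^] q \<ominus> x"
      using X x by (simp add: P_def UP.minus_eq minus_eq eval.hom_nat_pow eval_var)
    then show ?thesis
      using x by (simp add: is_root_def r_right_minus_eq)
  qed (simp add: is_root_def)
  \<comment> \<open>Since all multiplicities are one, the multiset of roots is the set of fixed
    points, and its size is the degree of \<open>P\<close>.\<close>
  have "count (roots P) x = (if x \<in> {x \<in> carrier L. x [^] q = x} then 1 else 0)" for x
  proof (cases "is_root P x")
    case True
    then have "alg_mult P x \<le> 1"
      using alg_mult_frobenius_le_1 [OF p char q P_def] root by blast
    moreover have "x \<in># roots P"
      using True roots_mem_iff_is_root [OF P] by blast
    ultimately have "count (roots P) x = 1"
      unfolding alg_mult_eq_count_roots [OF P] using count_greater_eq_one_iff [of "roots P" x]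
      by (intro antisym) blast+
    then show ?thesis
      using True root by simp
  next
    case False
    then have "x \<notin># roots P"
      using roots_mem_iff_is_root [OF P] by blast
    then show ?thesis
      using False by (simp add: root not_in_iff)
  qed
  moreover have "set_mset (roots P) = {x \<in> carrier L. x [^] q = x}"
    using roots_mem_iff_is_root [OF P] root by blast
  ultimately have "roots P = mset_set {x \<in> carrier L. x [^] q = x}"
    by (metis (no_types, lifting) count_mset_set(1,3) finite_set_mset multiset_eqI)
  then show ?thesis
    using roots_over_carrier [OF P] deg by (simp add: splitted_def)
qed

lemma subfield_frobenius_fixed:
  fixes p q n :: nat
  assumes p: "prime p" and char: "[p] \<cdot> \<one> = \<zero>" and q: "q = p ^ n"
  shows "subfield {x \<in> carrier L. x [^] q = x} L"
proof (intro subfieldI' subringI)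
  have add: "(x \<oplus> y) [^] q = x [^] q \<oplus> y [^] q" if "x \<in> carrier L" "y \<in> carrier L" for x y
    using frobenius_add [OF p char that] q by simp
  have q0: "q \<noteq> 0"
    using p q by auto
  {
    fix x assume x: "x \<in> {x \<in> carrier L. x [^] q = x}"
    \<comment> \<open>From \<open>0 = (x - x) ^ q = x + (- x) ^ q\<close> the power
      \<open>(- x) ^ q\<close> is the negative of \<open>x\<close>, without a case distinction on
      the parity of \<open>q\<close>.\<close>
    then have "x \<oplus> (\<ominus> x) [^] q = \<zero>"
      using add [of x "\<ominus> x"] q0 by (auto simp: r_neg nat_pow_zero)
    then show "\<ominus> x \<in> {x \<in> carrier L. x [^] q = x}"
      using x by (auto intro!: minus_equality [symmetric] simp: a_comm)
  }
  {
    fix x assume x: "x \<in> {x \<in> carrier L. x [^] q = x} - {\<zero>}"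
    then have i [simp]: "x \<in> Units L"
      by (auto simp: field_Units)
    have "x \<otimes> inv x [^] q = (x \<otimes> inv x) [^] q"
      using x i by (subst nat_pow_distrib) auto
    then have "inv x [^] q = inv x"
      using i x by (intro comm_inv_char [symmetric]) auto
    then show "inv x \<in> {x \<in> carrier L. x [^] q = x}"
      using i by auto
  }
qed (auto simp: nat_pow_distrib frobenius_add [OF p char] q)

end

text \<open>The field consists of the fixed points of the \<open>p ^ n\<close>-th power map in the
  algebraic closure of the integers modulo \<open>p\<close>. The element type is that of this
  closure, written out because types cannot be quantified existentially.\<close>

lemma exists_finite_field:
  fixes p n :: nat
  assumes p: "prime p" and n: "0 < n"
  shows "\<exists>F :: ((int list \<times> nat) multiset \<Rightarrow> int) ring. field F \<and> card (carrier F) = p ^ n"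
proof -
  let ?R = "residue_ring (int p)"
  interpret Zp: residues_prime p ?R
    by unfold_locales (use p in auto)
  let ?L = "Zp.alg_closure"
  interpret L: algebraic_closure ?L "Zp.indexed_const ` carrier ?R"
    by (rule Zp.alg_closureE)
  interpret emb: ring_hom_ring ?R ?L Zp.indexed_const
    using Zp.alg_closureE(2) by (intro ring_hom_ringI2 Zp.ring_axioms L.ring_axioms)
  have "[k] \<cdot>\<^bsub>?R\<^esub> \<one>\<^bsub>?R\<^esub> = int k mod int p" for k :: nat
    by (induction k) (simp_all add: Zp.res_zero_eq Zp.res_one_eq Zp.res_add_eq mod_simps add.commute)
  then have "[p] \<cdot>\<^bsub>?R\<^esub> \<one>\<^bsub>?R\<^esub> = \<zero>\<^bsub>?R\<^esub>"
    by (simp add: Zp.res_zero_eq)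
  note char = emb.char_image [OF this]
  have "2 \<le> p ^ n"
    using prime_ge_2_nat [OF p] n self_le_power [of p n] by linarith
  then have "card {x \<in> carrier ?L. x [^]\<^bsub>?L\<^esub> (p ^ n) = x} = p ^ n"
    by (intro L.card_frobenius_fixed [OF p char refl])
  moreover have "field (?L\<lparr>carrier := {x \<in> carrier ?L. x [^]\<^bsub>?L\<^esub> (p ^ n) = x}\<rparr>)"
    by (intro L.subfield_iff(2) L.subfield_frobenius_fixed [OF p char refl])
  ultimately show ?thesis
    by force
qed

section \<open>Latin squares and permutation matrices\<close>

text \<open>Turns bijections into the unique existence in which Latin squares, the Sudoku property
  and permutation matrices are phrased.\<close>

lemma bij_betw_ex1: "bij_betw f A B \<Longrightarrow> y \<in> B \<Longrightarrow> \<exists>!x. x \<in> A \<and> f x = y"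
  by (rule ex_ex1I) (auto simp: bij_betw_def inj_on_def)

lemma inj_on_card_imp_bij_betw:
  assumes "inj_on f A" "f ` A \<subseteq> B" "finite B" "card A = card B"
  shows "bij_betw f A B"
  using assms by (simp add: bij_betw_def card_subset_eq card_image)

lemma latin_square_mat:
  assumes row: "\<And>a. a < n \<Longrightarrow> bij_betw (\<lambda>b. f (a, b)) {..<n} {1..n}"
    and col: "\<And>b. b < n \<Longrightarrow> bij_betw (\<lambda>a. f (a, b)) {..<n} {1..n}"
  shows "latin_square n (mat n n f)"
proof -
  have "f (a, b) \<in> {1..n}" if "a < n" "b < n" for a b
    using bij_betw_apply [OF row] that by blast
  moreover have "\<exists>!b. b < n \<and> mat n n f $$ (a, b) = s" if "a < n" "s \<in> {1..n}" for a s
    using bij_betw_ex1 [OF row that(2)] that(1) by (simp cong: conj_cong)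
  moreover have "\<exists>!a. a < n \<and> mat n n f $$ (a, b) = s" if "b < n" "s \<in> {1..n}" for b s
    using bij_betw_ex1 [OF col that(2)] that(1) by (simp cong: conj_cong)
  ultimately show ?thesis
    unfolding latin_square_def by (intro conjI allI ballI impI) simp_all
qed

text \<open>A column contains a single one because \<open>\<sigma>\<close> is a function, a row
  because \<open>\<sigma>\<close> is bijective.\<close>

lemma permutation_matrix_of_bij:
  assumes "bij_betw \<sigma> {..<n} {..<n}"
  shows "permutation_matrix n (mat n n (\<lambda>(a, b). if a = \<sigma> b then 1 else 0))" (is "permutation_matrix n ?P")
proof -
  have 1: "?P $$ (a, b) = 1 \<longleftrightarrow> \<sigma> b = a" if "a < n" "b < n" for a b
    using that by auto
  have "\<exists>!b. b < n \<and> ?P $$ (a, b) = 1" if "a < n" for a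
    using bij_betw_ex1 [OF assms, of a] that by (simp add: 1 del: index_mat One_nat_def cong: conj_cong)
  moreover have "\<exists>!a. a < n \<and> ?P $$ (a, b) = 1" if "b < n" for b
    using that bij_betw_apply [OF assms, of b]
    by (intro ex1I [of _ "\<sigma> b"]) (simp_all add: 1 del: index_mat One_nat_def cong: conj_cong)
  ultimately show ?thesis
    unfolding permutation_matrix_def by (intro conjI allI impI) (simp_all del: One_nat_def)
qed

text \<open>Row \<open>a\<close> of \<open>P'\<close> has its one in column
  \<open>\<sigma> a\<close>, so \<open>P'\<close> on the left fetches row \<open>\<sigma> a\<close>
  of \<open>B\<close>; likewise \<open>Q\<close> on the right fetches column
  \<open>\<tau> b\<close>. The inverse \<open>P\<close> of \<open>P'\<close> is its
  transpose.\<close>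

lemma permuted_mat_eq_mult:
  assumes B: "B \<in> carrier_mat q r"
    and \<sigma>: "bij_betw \<sigma> {..<q} {..<q}" and \<tau>: "bij_betw \<tau> {..<r} {..<r}"
    and C: "C = mat q r (\<lambda>(a, b). B $$ (\<sigma> a, \<tau> b))"
  shows "\<exists>P P' Q. permutation_matrix q P \<and> permutation_matrix r Q \<and>
    P' \<in> carrier_mat q q \<and> inverts_mat P P' \<and> inverts_mat P' P \<and> C = P' * B * (Q :: nat mat)"
proof -
  define P :: "nat mat" where "P = mat q q (\<lambda>(a, b). if a = \<sigma> b then 1 else 0)"
  define P' :: "nat mat" where "P' = mat q q (\<lambda>(a, b). if b = \<sigma> a then 1 else 0)"
  define Q :: "nat mat" where "Q = mat r r (\<lambda>(a, b). if a = \<tau> b then 1 else 0)"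
  have \<sigma>_lt: "\<sigma> a < q" if "a < q" for a
    using bij_betw_apply [OF \<sigma>] that by auto
  have \<tau>_lt: "\<tau> a < r" if "a < r" for a
    using bij_betw_apply [OF \<tau>] that by auto
  have \<sigma>_inj: "\<sigma> a = \<sigma> b \<longleftrightarrow> a = b" if "a < q" "b < q" for a b
    using bij_betw_imp_inj_on [OF \<sigma>] that by (auto dest: inj_onD)
  have "inverts_mat P' P"
    unfolding inverts_mat_def P_def P'_def
    by (rule eq_matI)
      (auto simp: scalar_prod_def \<sigma>_lt \<sigma>_inj if_distrib [of "\<lambda>x. x * _"] sum.delta cong: if_cong)
  moreover have "inverts_mat P P'"
  proof -
    \<comment> \<open>This sum is entry \<open>(a, b)\<close> of \<open>P * P'\<close>; reindexing
      along the bijection \<open>\<sigma>\<close> turns it into the corresponding entry of the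
      identity.\<close>
    have "(\<Sum>k<q. (if a = \<sigma> k then 1 else 0) * (if b = \<sigma> k then 1 else 0)) = (if a = b then 1 else 0 :: nat)"
      if "a < q" for a b
    proof -
      have "(\<Sum>k<q. (if a = \<sigma> k then 1 else 0) * (if b = \<sigma> k then 1 else 0)) =
          (\<Sum>k<q. (if a = k then 1 else 0) * (if b = k then 1 else 0 :: nat))"
        by (rule sum.reindex_bij_betw [OF \<sigma>])
      also have "\<dots> = (if a = b then 1 else 0)"
        using that by (simp add: if_distrib [of "\<lambda>x. x * _"] sum.delta' cong: if_cong)
      finally show ?thesis .
    qed
    then show ?thesis
      unfolding inverts_mat_def P_def P'_def
      by (intro eq_matI) (auto simp: scalar_prod_def atLeast0LessThan)
  qed
  moreover have "C = P' * B * Q"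
  proof (rule eq_matI)
    fix a b
    assume "a < dim_row (P' * B * Q)" "b < dim_col (P' * B * Q)"
    then have a: "a < q" and b: "b < r"
      by (simp_all add: P'_def Q_def)
    have PB: "(P' * B) $$ (a, d) = B $$ (\<sigma> a, d)" if "d < r" for d
      using a B that \<sigma>_lt [OF a]
      by (auto simp: P'_def scalar_prod_def if_distrib [of "\<lambda>x. x * _"] sum.delta cong: if_cong)
    have "(P' * B * Q) $$ (a, b) = (\<Sum>d<r. (P' * B) $$ (a, d) * Q $$ (d, b))"
      using a b B by (auto simp: P'_def Q_def scalar_prod_def atLeast0LessThan)
    also have "\<dots> = (\<Sum>d<r. if d = \<tau> b then B $$ (\<sigma> a, d) else 0)"
      using b by (intro sum.cong) (auto simp: PB Q_def)
    finally show "C $$ (a, b) = (P' * B * Q) $$ (a, b)"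
      using a b \<tau>_lt [OF b] by (simp add: C)
  qed (simp_all add: C P'_def Q_def)
  ultimately show ?thesis
    using permutation_matrix_of_bij [OF \<sigma>] permutation_matrix_of_bij [OF \<tau>]
    unfolding P_def [symmetric] Q_def [symmetric] by (intro exI conjI) (auto simp: P'_def)
qed

section \<open>Sudoku squares over a finite field\<close>

text \<open>Index \<open>i * h + b\<close> goes to \<open>s i + e b\<close>, where \<open>s\<close>
  represents the \<open>k\<close> cosets counted by Lagrange and \<open>e\<close> enumerates
  \<open>H\<close>; so the indices with the same quotient by \<open>h\<close> fill one coset.
  Surjectivity is checked directly, and injectivity follows by cardinality.\<close>

lemma (in abelian_group) subgroup_transversal:
  assumes H: "additive_subgroup H G" and h: "card H = h" "0 < h"
    and G: "card (carrier G) = h * k" "0 < k"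
  shows "\<exists>s e. s ` {..<k} \<subseteq> carrier G \<and> bij_betw e {..<h} H \<and>
    bij_betw (\<lambda>x. s (x div h) \<oplus> e (x mod h)) {..<h * k} (carrier G)"
proof -
  interpret H: additive_subgroup H G by (rule H)
  have fin: "finite (carrier G)" "finite H"
    using h G by (auto intro: card_ge_0_finite)
  obtain e where e: "bij_betw e {..<h} H"
    using ex_bij_betw_nat_finite [OF fin(2)] h by (auto simp: atLeast0LessThan)
  have sub: "subgroup H (add_monoid G)"
    by (rule H.a_subgroup)
  have "card (a_rcosets H) * h = h * k"
    using add.lagrange_finite [OF _ sub] fin h G
    by (simp add: A_RCOSETS_defs RCOSETS_def a_r_coset_def order_def)
  then have "card (a_rcosets H) = k"
    using h by simp
  moreover have "finite (a_rcosets H)"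
    using calculation G by (auto intro: card_ge_0_finite)
  ultimately obtain c where c: "bij_betw c {..<k} (a_rcosets H)"
    using ex_bij_betw_nat_finite by (metis atLeast0LessThan)
  have "\<exists>g. g \<in> carrier G \<and> c i = H +> g" if "i < k" for i
    using bij_betw_apply [OF c, of i] that by (auto simp: A_RCOSETS_defs a_r_coset_def)
  then obtain s where s: "\<And>i. i < k \<Longrightarrow> s i \<in> carrier G" "\<And>i. i < k \<Longrightarrow> c i = H +> s i"
    by metis
  let ?\<rho> = "\<lambda>x. s (x div h) \<oplus> e (x mod h)"
  have div: "x div h < k" "x mod h < h" if "x < h * k" for x
    using that h by (auto simp: less_mult_imp_div_less mult.commute)
  have eH: "e b \<in> H" if "b < h" for b
    using bij_betw_apply [OF e] that by blast
  have "?\<rho> ` {..<h * k} = carrier G"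
  proof (intro equalityI subsetI)
    fix g assume g: "g \<in> carrier G"
    then have "H +> g \<in> a_rcosets H"
      by (auto simp: A_RCOSETS_defs a_r_coset_def)
    then obtain i where i: "i < k" "c i = H +> g"
      using bij_betw_ex1 [OF c] by (metis lessThan_iff)
    have "g \<in> H +> s i"
      using add.rcos_self [OF g sub] s(2) [OF i(1)] i(2) by (simp add: a_r_coset_def)
    then obtain u where u: "u \<in> H" "g = u \<oplus> s i"
      by (auto simp: a_r_coset_defs)
    then obtain b where b: "b < h" "u = e b"
      using bij_betw_ex1 [OF e] by (metis lessThan_iff)
    have "i * h + b < h * k"
    proof -
      have "i * h + b < Suc i * h" using b by simp
      also have "\<dots> \<le> k * h" using i by (intro mult_le_mono1) simp
      finally show ?thesis by (simp add: mult.commute)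
    qed
    moreover have "g = ?\<rho> (i * h + b)"
      using b u s(1) [OF i(1)] H.a_Hcarr [OF u(1)] by (simp add: a_comm)
    ultimately show "g \<in> ?\<rho> ` {..<h * k}"
      by blast
  qed (use div s eH H.a_Hcarr in force)
  then have "bij_betw ?\<rho> {..<h * k} (carrier G)"
    using G by (auto simp: bij_betw_def intro!: eq_card_imp_inj_on)
  then show ?thesis
    using e s by (intro exI [of _ s] exI [of _ e]) auto
qed

section \<open>Sums of \<open>c U\<close> and \<open>V\<close>, and the squares they yield\<close>

locale sudoku_field = field K for K (structure) +
  fixes U V :: "'a set" and q r :: nat
  assumes U: "additive_subgroup U K" and V: "additive_subgroup V K"
    and card_U: "card U = q" and card_V: "card V = r"
    and card_K: "card (carrier K) = q * r" and q_pos: "0 < q" and r_pos: "0 < r"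
begin

sublocale U: additive_subgroup U K by (rule U)
sublocale V: additive_subgroup V K by (rule V)

lemma finite_carrier: "finite (carrier K)"
  using card_K q_pos r_pos by (auto intro: card_ge_0_finite)

text \<open>The scalars \<open>c\<close> for which \<open>K\<close> is the direct sum of \<open>c U\<close> and \<open>V\<close>.\<close>
definition scalars :: "'a set" where
  "scalars = {c \<in> carrier K - {\<zero>}. \<forall>u\<in>U. c \<otimes> u \<in> V \<longrightarrow> u = \<zero>}"

text \<open>If two sums agree, then \<open>c (u - u')\<close> lies in \<open>V\<close>, which forces
  \<open>u = u'\<close> and then \<open>v = v'\<close>. Surjectivity follows because both sides have
  \<open>q * r\<close> elements.\<close>

lemma bij_betw_scalar_sum:
  assumes "c \<in> scalars"
  shows "bij_betw (\<lambda>(u, v). c \<otimes> u \<oplus> v) (U \<times> V) (carrier K)"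
proof -
  have c [simp]: "c \<in> carrier K"
    using assms by (simp add: scalars_def)
  have "inj_on (\<lambda>(u, v). c \<otimes> u \<oplus> v) (U \<times> V)"
  proof (rule inj_onI, clarify)
    fix u v u' v'
    assume *: "u \<in> U" "v \<in> V" "u' \<in> U" "v' \<in> V" and eq: "c \<otimes> u \<oplus> v = c \<otimes> u' \<oplus> v'"
    have cl [simp]: "u \<in> carrier K" "u' \<in> carrier K" "v \<in> carrier K" "v' \<in> carrier K"
      using * by (auto intro: U.a_Hcarr V.a_Hcarr)
    have "c \<otimes> (u \<ominus> u') = c \<otimes> u \<oplus> v \<ominus> v \<ominus> c \<otimes> u'"
      using c cl by algebra
    also have "\<dots> = v' \<ominus> v"
      unfolding eq using c cl by algebra
    finally have "c \<otimes> (u \<ominus> u') \<in> V"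
      using * by (simp add: minus_eq V.a_closed V.a_inv_closed)
    moreover have "u \<ominus> u' \<in> U"
      using * by (simp add: minus_eq U.a_closed U.a_inv_closed)
    ultimately have "u \<ominus> u' = \<zero>"
      using assms unfolding scalars_def by blast
    then have "u = u'"
      by simp
    then show "u = u' \<and> v = v'"
      using eq by simp
  qed
  moreover have "(\<lambda>(u, v). c \<otimes> u \<oplus> v) ` (U \<times> V) \<subseteq> carrier K"
    using c by (auto simp: U.a_Hcarr V.a_Hcarr)
  ultimately show ?thesis
    by (intro inj_on_card_imp_bij_betw finite_carrier)
      (simp_all add: card_cartesian_product card_U card_V card_K)
qed

text \<open>\<open>\<sigma>\<close> is the translation of \<open>H\<close> by \<open>g\<close>, read
  on indices through \<open>e\<close>. It realizes shifts by \<open>U\<close> or \<open>V\<close> as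
  permutations of the rows or columns of a block.\<close>

lemma translation_permutes:
  assumes H: "additive_subgroup H K" and e: "bij_betw e {..<h} H" and g: "g \<in> H"
  shows "\<exists>\<sigma>. bij_betw \<sigma> {..<h} {..<h} \<and> (\<forall>a<h. e (\<sigma> a) = e a \<oplus> g)"
proof -
  interpret H: additive_subgroup H K by (rule H)
  have "bij_betw (\<lambda>x. x \<oplus> g) H H"
    by (rule bij_betw_byWitness [of _ "\<lambda>x. x \<ominus> g"])
      (use g in \<open>auto simp: minus_eq a_assoc r_neg l_neg H.a_Hcarr H.a_closed H.a_inv_closed\<close>)
  then have "bij_betw (\<lambda>a. inv_into {..<h} e (e a \<oplus> g)) {..<h} {..<h}"
    using bij_betw_trans [OF bij_betw_trans [OF e] bij_betw_inv_into [OF e]] by (simp add: comp_def)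
  moreover have "e (inv_into {..<h} e (e a \<oplus> g)) = e a \<oplus> g" if "a < h" for a
    using that g e bij_betw_apply [OF e, of a] by (intro bij_betw_inv_into_right) auto
  ultimately show ?thesis
    by blast
qed


text \<open>Every excluded \<open>c = v / u\<close> is also the ratio of the \<open>p - 1\<close> distinct pairs \<open>(k u, k v)\<close>, \<open>0 < k < p\<close>.\<close>
lemma card_nonscalars:
  assumes p: "prime p" and N: "q * r = p ^ N"
  shows "(p - 1) * card (carrier K - {\<zero>} - scalars) \<le> (q - 1) * (r - 1)"
proof -
  let ?B = "carrier K - {\<zero>} - scalars"
  have "\<forall>c\<in>?B. \<exists>u. u \<in> U - {\<zero>} \<and> c \<otimes> u \<in> V"
    by (auto simp: scalars_def)
  then obtain w where w: "\<And>c. c \<in> ?B \<Longrightarrow> w c \<in> U - {\<zero>}" "\<And>c. c \<in> ?B \<Longrightarrow> c \<otimes> w c \<in> V"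
    by metis
  have closed: "[(k::nat)] \<cdot> x \<in> H" if "additive_subgroup H K" "x \<in> H" for k x H
  proof -
    interpret H: additive_subgroup H K by (rule that)
    show ?thesis
      using that by (induction k) (simp_all add: H.a_closed)
  qed
  have nonzero: "[k] \<cdot> x \<noteq> \<zero>" if x: "x \<in> carrier K - {\<zero>}" and k: "0 < k" "k < p" for k :: nat and x
  proof
    \<comment> \<open>The additive order of \<open>x\<close> would divide both \<open>k\<close> and
      \<open>p ^ N\<close>, which are coprime, so it would be one and \<open>x\<close> would be
      zero.\<close>
    assume "[k] \<cdot> x = \<zero>"
    then have "add.ord x dvd k"
      using x by (simp add: add.pow_eq_id)
    moreover have "add.ord x dvd p ^ N"
      using add.ord_dvd_group_order [of x] x by (simp add: order_def card_K N)
    moreover have "coprime k (p ^ N)"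
      using p k by (metis coprime_commute coprime_power_right_iff nat_dvd_not_less prime_imp_coprime)
    ultimately have "add.ord x = 1"
      by (meson coprime_common_divisor_nat)
    then show False
      using x add.ord_eq_1 [of x] by simp
  qed
  have inj: "k = k'" if x: "x \<in> carrier K - {\<zero>}" and k: "k \<in> {1..<p}" "k' \<in> {1..<p}"
    and eq: "[k] \<cdot> x = [k'] \<cdot> x" for k k' :: nat and x
  proof -
    have "\<not> i < j" if "i \<in> {1..<p}" "j \<in> {1..<p}" "[i] \<cdot> x = [j] \<cdot> x" for i j :: nat
    proof
      assume "i < j"
      then have "[i] \<cdot> x \<oplus> [(j - i)] \<cdot> x = [j] \<cdot> x"
        using x add.nat_pow_mult [of x i "j - i"] by simp
      then have "[i] \<cdot> x \<oplus> [(j - i)] \<cdot> x = [i] \<cdot> x"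
        using that(3) by simp
      then have "[(j - i)] \<cdot> x = \<zero>"
        using x by (simp add: add.l_cancel_one)
      then show False
        using nonzero [OF x, of "j - i"] \<open>i < j\<close> \<open>j \<in> {1..<p}\<close>
        by (simp add: less_imp_diff_less)
    qed
    then show ?thesis
      using k eq by (metis linorder_neqE_nat)
  qed
  \<comment> \<open>The ratio of the second entry to the first recovers \<open>c\<close>; the first
    entry, a multiple of the chosen \<open>w c\<close>, then recovers \<open>k\<close>.\<close>
  let ?f = "\<lambda>(c, k::nat). ([k] \<cdot> w c, [k] \<cdot> (c \<otimes> w c))"
  have carr: "w c \<in> carrier K - {\<zero>}" "c \<in> carrier K" if "c \<in> ?B" for c
    using w(1) [OF that] that U.a_Hcarr by auto
  have "inj_on ?f (?B \<times> {1..<p})"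
  proof (rule inj_onI)
    fix x y assume "x \<in> ?B \<times> {1..<p}" "y \<in> ?B \<times> {1..<p}" "?f x = ?f y"
    moreover obtain c k c' k' where xy: "x = (c, k)" "y = (c', k')"
      by (metis surj_pair)
    ultimately have c: "c \<in> carrier K" "c \<noteq> \<zero>" "c \<notin> scalars"
      and c': "c' \<in> carrier K" "c' \<noteq> \<zero>" "c' \<notin> scalars"
      and k: "k \<in> {1..<p}" "k' \<in> {1..<p}"
      and eq: "[k] \<cdot> w c = [k'] \<cdot> w c'" "[k] \<cdot> (c \<otimes> w c) = [k'] \<cdot> (c' \<otimes> w c')"
      by auto
    have wc: "w c \<in> carrier K - {\<zero>}" "w c' \<in> carrier K"
      using carr(1) c c' by auto
    have "[k] \<cdot> w c \<noteq> \<zero>"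
      using nonzero [OF wc(1)] k by auto
    moreover have "c \<otimes> [k] \<cdot> w c = c' \<otimes> [k] \<cdot> w c"
      using add_pow_rdistr [of c "w c" k] add_pow_rdistr [of c' "w c'" k'] eq wc c c' by simp
    ultimately have "c = c'"
      using wc c c' by (simp add: m_rcancel)
    then show "x = y"
      using inj [OF wc(1) k] eq(1) by (simp add: xy)
  qed
  moreover have "?f ` (?B \<times> {1..<p}) \<subseteq> (U - {\<zero>}) \<times> (V - {\<zero>})"
  proof (rule image_subsetI)
    fix x assume "x \<in> ?B \<times> {1..<p}"
    then obtain c k where x: "x = (c, k)" and cB: "c \<in> ?B" and k: "k \<in> {1..<p}"
      by blast
    have "[k] \<cdot> w c \<in> U - {\<zero>}"
      using closed [OF U] w(1) [OF cB] nonzero [OF carr(1) [OF cB], of k] k by auto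
    moreover have "c \<otimes> w c \<in> carrier K - {\<zero>}"
      using cB carr [OF cB] by (auto simp: integral_iff)
    then have "[k] \<cdot> (c \<otimes> w c) \<in> V - {\<zero>}"
      using closed [OF V] w(2) [OF cB] nonzero [of "c \<otimes> w c" k] k by auto
    ultimately show "?f x \<in> (U - {\<zero>}) \<times> (V - {\<zero>})"
      by (simp add: x)
  qed
  moreover have "finite U" "finite V"
    using finite_carrier finite_subset U.a_subset V.a_subset by blast+
  ultimately have "card (?B \<times> {1..<p}) \<le> card ((U - {\<zero>}) \<times> (V - {\<zero>}))"
    by (intro card_inj_on_le [of ?f]) auto
  then show ?thesis
    using \<open>finite U\<close> \<open>finite V\<close>
    by (simp add: card_cartesian_product card_U card_V U.zero_closed V.zero_closed mult.commute)
qed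

lemma bij_betw_translate:
  assumes "g \<in> carrier K"
  shows "bij_betw (\<lambda>z. g \<oplus> z) (carrier K) (carrier K)"
  using assms by (intro inj_on_card_imp_bij_betw finite_carrier) (auto simp: inj_on_def)

lemma bij_betw_scale:
  assumes "c \<in> carrier K" "c \<noteq> \<zero>"
  shows "bij_betw (\<lambda>z. c \<otimes> z) (carrier K) (carrier K)"
  using assms by (intro inj_on_card_imp_bij_betw finite_carrier) (auto simp: inj_on_def m_lcancel)

text \<open>The labels of rows, columns and symbols are chosen once for all scalars, so that two
  squares differ in the factor \<open>c\<close> alone; orthogonality rests on this.\<close>

lemma exists_squares:
  "\<exists>L. (\<forall>c\<in>scalars. sudoku_latin_square q r (L c) \<and> block_permutational q r (L c)) \<and>
    (\<forall>c\<in>scalars. \<forall>d\<in>scalars. c \<noteq> d \<longrightarrow> orthogonal_squares (q * r) (L c) (L d))"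
proof -
  obtain s e where s: "s ` {..<r} \<subseteq> carrier K" and e: "bij_betw e {..<q} U"
    and \<rho>: "bij_betw (\<lambda>x. s (x div q) \<oplus> e (x mod q)) {..<q * r} (carrier K)"
    using subgroup_transversal [OF U card_U q_pos card_K r_pos] by blast
  \<comment> \<open>The roles of \<open>q\<close> and \<open>r\<close> are exchanged here:
    \<open>V\<close> has order \<open>r\<close> and \<open>q\<close> cosets.\<close>
  obtain t f where t: "t ` {..<q} \<subseteq> carrier K" and f: "bij_betw f {..<r} V"
    and \<gamma>: "bij_betw (\<lambda>y. t (y div r) \<oplus> f (y mod r)) {..<q * r} (carrier K)"
    using subgroup_transversal [OF V card_V r_pos _ q_pos] card_K by (metis mult.commute)
  obtain enc where enc: "bij_betw enc (carrier K) {1..q * r}"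
    using finite_same_card_bij [OF finite_carrier, of "{1..q * r}"] card_K by auto
  \<comment> \<open>The rows of a band of blocks are labelled by a coset of \<open>U\<close>, the columns of a stack by a coset of \<open>V\<close>.\<close>
  define row where "row = (\<lambda>x. s (x div q) \<oplus> e (x mod q))"
  define col where "col = (\<lambda>y. t (y div r) \<oplus> f (y mod r))"
  define L where "L = (\<lambda>c. mat (q * r) (q * r) (\<lambda>(x, y). enc (c \<otimes> row x \<oplus> col y)))"
  have row: "bij_betw row {..<q * r} (carrier K)" and col: "bij_betw col {..<q * r} (carrier K)"
    using \<rho> \<gamma> by (simp_all add: row_def col_def)
  have row_closed: "row x \<in> carrier K" and col_closed: "col x \<in> carrier K" if "x < q * r" for x
    using bij_betw_apply [OF row] bij_betw_apply [OF col] that by auto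
  have se: "s i \<in> carrier K" "e a \<in> U" "e a \<in> carrier K" if "i < r" "a < q" for i a
    using s that bij_betw_apply [OF e] U.a_subset by blast+
  have tf: "t j \<in> carrier K" "f b \<in> V" "f b \<in> carrier K" if "j < q" "b < r" for j b
    using t that bij_betw_apply [OF f] V.a_subset by blast+
  have scalar: "c \<in> carrier K" "c \<noteq> \<zero>" if "c \<in> scalars" for c
    using that by (simp_all add: scalars_def)
  \<comment> \<open>Division with remainder gives row \<open>i * q + a\<close> the label
    \<open>s i + e a\<close> and column \<open>j * r + b\<close> the label
    \<open>t j + f b\<close>.\<close>
  have block_L: "block q r (L c) i j = mat q r (\<lambda>(a, b). enc (c \<otimes> (s i \<oplus> e a) \<oplus> (t j \<oplus> f b)))"
    if "i < r" "j < q" for c i j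
  proof (rule eq_matI)
    fix a b
    assume "a < dim_row (mat q r (\<lambda>(a, b). enc (c \<otimes> (s i \<oplus> e a) \<oplus> (t j \<oplus> f b))))"
      "b < dim_col (mat q r (\<lambda>(a, b). enc (c \<otimes> (s i \<oplus> e a) \<oplus> (t j \<oplus> f b))))"
    then have ab: "a < q" "b < r"
      by simp_all
    have "i * q + a < Suc i * q" "j * r + b < Suc j * r"
      using ab by simp_all
    moreover have "Suc i * q \<le> r * q" "Suc j * r \<le> q * r"
      using that by (intro mult_le_mono1; simp)+
    ultimately have "i * q + a < q * r" "j * r + b < q * r"
      by (simp_all only: mult.commute [of r q])
    then show "block q r (L c) i j $$ (a, b) =
        mat q r (\<lambda>(a, b). enc (c \<otimes> (s i \<oplus> e a) \<oplus> (t j \<oplus> f b))) $$ (a, b)"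
      using ab by (simp add: block_def L_def row_def col_def)
  qed (simp_all add: block_def)
  have "latin_square (q * r) (L c)" if c: "c \<in> scalars" for c
    unfolding L_def
  proof (rule latin_square_mat)
    fix x assume "x < q * r"
    then have "bij_betw (enc \<circ> (\<lambda>z. c \<otimes> row x \<oplus> z) \<circ> col) {..<q * r} {1..q * r}"
      using scalar [OF c] row_closed
      by (intro bij_betw_trans [OF col] bij_betw_trans [OF bij_betw_translate enc]) simp
    then show "bij_betw (\<lambda>y. case (x, y) of (x, y) \<Rightarrow> enc (c \<otimes> row x \<oplus> col y)) {..<q * r} {1..q * r}"
      by (simp add: comp_def)
  next
    fix y assume y: "y < q * r"
    then have "bij_betw (enc \<circ> (\<lambda>z. col y \<oplus> z) \<circ> (\<lambda>z. c \<otimes> z) \<circ> row) {..<q * r} {1..q * r}"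
      using scalar [OF c] col_closed
      by (intro bij_betw_trans [OF row] bij_betw_trans [OF bij_betw_scale] bij_betw_trans [OF bij_betw_translate enc])
    moreover have "(enc \<circ> (\<lambda>z. col y \<oplus> z) \<circ> (\<lambda>z. c \<otimes> z) \<circ> row) x = enc (c \<otimes> row x \<oplus> col y)" if "x < q * r" for x
      using scalar [OF c] row_closed [OF that] col_closed [OF y] by (simp add: a_comm)
    ultimately show "bij_betw (\<lambda>x. case (x, y) of (x, y) \<Rightarrow> enc (c \<otimes> row x \<oplus> col y)) {..<q * r} {1..q * r}"
      by (subst bij_betw_cong) auto
  qed
  moreover have "\<exists>!z. z \<in> {..<q} \<times> {..<r} \<and> block q r (L c) i j $$ z = y"
    if c: "c \<in> scalars" and ij: "i < r" "j < q" and y: "y \<in> {1..q * r}" for c i j y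
  proof -
    \<comment> \<open>An entry of the block is \<open>enc\<close> of \<open>?g + (c u + v)\<close>
      with \<open>u = e a\<close> in \<open>U\<close> and \<open>v = f b\<close> in
      \<open>V\<close>, so the direct sum decomposition makes the block a bijection onto the
      symbols.\<close>
    let ?g = "c \<otimes> s i \<oplus> t j"
    have g: "?g \<in> carrier K"
      using scalar [OF c] se(1) [OF ij(1) q_pos] tf(1) [OF ij(2) r_pos] by simp
    have "bij_betw (map_prod e f) ({..<q} \<times> {..<r}) (U \<times> V)"
      using e f by (rule bij_betw_map_prod)
    then have "bij_betw (enc \<circ> (\<lambda>z. ?g \<oplus> z) \<circ> (\<lambda>(u, v). c \<otimes> u \<oplus> v) \<circ> map_prod e f) ({..<q} \<times> {..<r}) {1..q * r}"
      by (rule bij_betw_trans)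
        (intro bij_betw_trans [OF bij_betw_scalar_sum [OF c]] bij_betw_trans [OF bij_betw_translate [OF g] enc])
    moreover have "(enc \<circ> (\<lambda>z. ?g \<oplus> z) \<circ> (\<lambda>(u, v). c \<otimes> u \<oplus> v) \<circ> map_prod e f) z = block q r (L c) i j $$ z"
      if "z \<in> {..<q} \<times> {..<r}" for z
      using that scalar [OF c] se [OF ij(1)] tf [OF ij(2)] by (auto simp: block_L [OF ij] r_distr a_ac)
    ultimately have "bij_betw (\<lambda>z. block q r (L c) i j $$ z) ({..<q} \<times> {..<r}) {1..q * r}"
      by (subst (asm) bij_betw_cong)
    then show ?thesis
      using y by (rule bij_betw_ex1)
  qed
  moreover have "block_permutational q r (L c)" if c: "c \<in> scalars" for c
    unfolding block_permutational_def
  proof (intro allI impI)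
    fix i j assume ij: "i < r" "j < q"
    note 0 = r_pos q_pos
    \<comment> \<open>Block \<open>(i, j)\<close> is block \<open>(0, 0)\<close> shifted by \<open>?g\<close>, and \<open>?g = c u + v\<close> translates rows by \<open>u\<close>, columns by \<open>v\<close>.\<close>
    let ?g = "(c \<otimes> s i \<oplus> t j) \<ominus> (c \<otimes> s 0 \<oplus> t 0)"
    have cl: "c \<in> carrier K" "s i \<in> carrier K" "t j \<in> carrier K" "s 0 \<in> carrier K" "t 0 \<in> carrier K"
      using scalar [OF c] se(1) tf(1) ij 0 by auto
    then have "?g \<in> carrier K"
      by simp
    then obtain u v where uv: "u \<in> U" "v \<in> V" "c \<otimes> u \<oplus> v = ?g"
      using bij_betw_scalar_sum [OF c] unfolding bij_betw_def by force
    obtain \<sigma> where \<sigma>: "bij_betw \<sigma> {..<q} {..<q}" "\<And>a. a < q \<Longrightarrow> e (\<sigma> a) = e a \<oplus> u"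
      using translation_permutes [OF U e uv(1)] by blast
    obtain \<tau> where \<tau>: "bij_betw \<tau> {..<r} {..<r}" "\<And>b. b < r \<Longrightarrow> f (\<tau> b) = f b \<oplus> v"
      using translation_permutes [OF V f uv(2)] by blast
    have "block q r (L c) i j = mat q r (\<lambda>(a, b). block q r (L c) 0 0 $$ (\<sigma> a, \<tau> b))"
    proof (rule eq_matI)
      fix a b
      assume "a < dim_row (mat q r (\<lambda>(a, b). block q r (L c) 0 0 $$ (\<sigma> a, \<tau> b)))"
        "b < dim_col (mat q r (\<lambda>(a, b). block q r (L c) 0 0 $$ (\<sigma> a, \<tau> b)))"
      then have ab: "a < q" "b < r"
        by simp_all
      then have ab': "\<sigma> a < q" "\<tau> b < r"
        using bij_betw_apply [OF \<sigma>(1)] bij_betw_apply [OF \<tau>(1)] by auto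
      have ef: "e a \<in> carrier K" "f b \<in> carrier K" "u \<in> carrier K" "v \<in> carrier K"
        using se(3) [OF 0(1) ab(1)] tf(3) [OF 0(2) ab(2)] uv U.a_subset V.a_subset by auto
      have "c \<otimes> (s 0 \<oplus> e (\<sigma> a)) \<oplus> (t 0 \<oplus> f (\<tau> b))
          = (c \<otimes> e a \<oplus> f b) \<oplus> (c \<otimes> s 0 \<oplus> t 0) \<oplus> (c \<otimes> u \<oplus> v)"
        unfolding \<sigma>(2) [OF ab(1)] \<tau>(2) [OF ab(2)] using cl ef by algebra
      also have "\<dots> = c \<otimes> (s i \<oplus> e a) \<oplus> (t j \<oplus> f b)"
        unfolding uv(3) using cl ef by algebra
      finally show "block q r (L c) i j $$ (a, b) = mat q r (\<lambda>(a, b). block q r (L c) 0 0 $$ (\<sigma> a, \<tau> b)) $$ (a, b)"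
        using ab ab' by (simp add: block_L [OF ij] block_L [OF 0])
    qed (simp_all add: block_def)
    then show "\<exists>P P' Q. permutation_matrix q P \<and> permutation_matrix r Q \<and> P' \<in> carrier_mat q q \<and>
        inverts_mat P P' \<and> inverts_mat P' P \<and> block q r (L c) i j = P' * block q r (L c) 0 0 * Q"
      by (intro permuted_mat_eq_mult [OF _ \<sigma>(1) \<tau>(1)]) (simp_all add: block_def)
  qed
  moreover have "orthogonal_squares (q * r) (L c) (L d)"
    if c: "c \<in> scalars" and d: "d \<in> scalars" and "c \<noteq> d" for c d
    unfolding orthogonal_squares_def
  proof (rule inj_onI, clarify)
    fix x y x' y'
    assume xy: "x < q * r" "y < q * r" "x' < q * r" "y' < q * r"
      and "L c $$ (x, y) = L c $$ (x', y')" "L d $$ (x, y) = L d $$ (x', y')"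
    note cl = scalar(1) [OF c] scalar(1) [OF d] xy [THEN row_closed] xy [THEN col_closed]
    have "c \<otimes> row x \<oplus> col y = c \<otimes> row x' \<oplus> col y'" "d \<otimes> row x \<oplus> col y = d \<otimes> row x' \<oplus> col y'"
      using \<open>L c $$ (x, y) = _\<close> \<open>L d $$ (x, y) = _\<close> cl xy bij_betw_imp_inj_on [OF enc]
      by (auto simp: L_def dest: inj_onD)
    note eq = this
    \<comment> \<open>Subtracting the two equations eliminates the column labels; the nonzero factor
      \<open>c - d\<close> then cancels.\<close>
    have "(c \<ominus> d) \<otimes> row x = (c \<otimes> row x \<oplus> col y) \<ominus> (d \<otimes> row x \<oplus> col y)"
      using cl by algebra
    also have "\<dots> = (c \<ominus> d) \<otimes> row x'"
      unfolding eq using cl by algebra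
    finally have rows: "row x = row x'"
      using cl \<open>c \<noteq> d\<close> by (simp add: m_lcancel)
    then have "col y = col y'"
      using eq(1) cl by simp
    with rows show "x = x' \<and> y = y'"
      using xy bij_betw_imp_inj_on [OF row] bij_betw_imp_inj_on [OF col] by (auto dest: inj_onD)
  qed
  ultimately show ?thesis
    unfolding sudoku_latin_square_def by blast
qed

end

section \<open>Counting the scalars and choosing the squares\<close>

text \<open>After multiplication by \<open>p - 1\<close> and insertion of the bound on
  \<open>B\<close>, the slack is \<open>(p - 1) (a b - 1) - (a - 1) (b - 1) - (p - 1) ^ 2 a = ((p -
  2) a + 1) (b - p)\<close>, which is nonnegative.\<close>

lemma nonscalar_count_le:
  fixes p a b :: nat
  assumes "2 \<le> p" "p \<le> a" "p \<le> b" and bad: "(p - 1) * B \<le> (a - 1) * (b - 1)"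
  shows "a * (p - 1) + B \<le> a * b - 1"
proof -
  \<comment> \<open>The computation takes place in the integers, where subtraction does not
    truncate.\<close>
  have "0 \<le> (int p - 2) * int a * (int b - int p) + (int b - int p)"
    using assms by (intro add_nonneg_nonneg mult_nonneg_nonneg) auto
  also have "\<dots> = (int p - 1) * (int a * int b - 1) - (int a - 1) * (int b - 1) - (int p - 1) * (int a * (int p - 1))"
    by (simp add: algebra_simps)
  finally have "(int p - 1) * (int a * (int p - 1)) + (int a - 1) * (int b - 1) \<le> (int p - 1) * (int a * int b - 1)"
    by simp
  moreover have "int ((p - 1) * B) \<le> int ((a - 1) * (b - 1))"
    using bad by (simp only: of_nat_le_iff)
  then have "(int p - 1) * int B \<le> (int a - 1) * (int b - 1)"
    using assms by (simp add: of_nat_diff)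
  ultimately have "(int p - 1) * (int a * (int p - 1) + int B) \<le> (int p - 1) * (int a * int b - 1)"
    by (simp add: distrib_left)
  then have "int a * (int p - 1) + int B \<le> int a * int b - 1"
    using assms by (simp add: mult_le_cancel_left)
  then have "int (a * (p - 1) + B) \<le> int (a * b) - 1"
    using assms by (simp add: of_nat_diff)
  then show ?thesis
    by linarith
qed

text \<open>The \<open>q r - 1\<close> nonzero elements are either scalars or excluded ratios. The
  bound on the latter is symmetric in \<open>q\<close> and \<open>r\<close>, so the count applies in
  both orders and yields the maximum.\<close>

lemma (in sudoku_field) card_scalars_ge:
  assumes p: "prime p" and qr: "q = p ^ m" "r = p ^ n" "0 < m" "0 < n"
  shows "max (q * (p - 1)) (r * (p - 1)) \<le> card scalars"
proof -
  let ?B = "card (carrier K - {\<zero>} - scalars)"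
  have "scalars \<subseteq> carrier K - {\<zero>}"
    by (auto simp: scalars_def)
  then have "?B + card scalars = q * r - 1"
    using finite_carrier card_mono [of "carrier K - {\<zero>}" scalars]
    by (simp add: card_Diff_subset finite_subset card_K)
  moreover have "2 \<le> p" "p \<le> q" "p \<le> r"
    using prime_ge_2_nat [OF p] qr self_le_power [of p m] self_le_power [of p n] by auto
  moreover have "(p - 1) * ?B \<le> (q - 1) * (r - 1)"
    by (rule card_nonscalars [OF p, of "m + n"]) (simp add: qr power_add)
  ultimately have "q * (p - 1) + ?B \<le> q * r - 1" "r * (p - 1) + ?B \<le> q * r - 1"
    using nonscalar_count_le [of p q r ?B] nonscalar_count_le [of p r q ?B] by (simp_all add: mult.commute)
  then show ?thesis
    using \<open>?B + _ = _\<close> by linarith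
qed

text \<open>\<open>U\<close> and \<open>V\<close> come from Sylow's theorem for the additive group
  of the field of order \<open>p ^ (m + n)\<close>, in the form that covers every power of
  \<open>p\<close> dividing the group order.\<close>

lemma exists_sudoku_field:
  assumes p: "prime p" and "0 < m" "0 < n"
  shows "\<exists>(K :: ((int list \<times> nat) multiset \<Rightarrow> int) ring) U V. sudoku_field K U V (p ^ m) (p ^ n)"
proof -
  obtain K :: "((int list \<times> nat) multiset \<Rightarrow> int) ring"
    where K: "field K" "card (carrier K) = p ^ (m + n)"
    using exists_finite_field [OF p, of "m + n"] assms by auto
  interpret field K by (rule K)
  have pos: "0 < p ^ k" for k
    using p by (simp add: prime_gt_0_nat)
  have fin: "finite (carrier (add_monoid K))"
    using K pos [of "m + n"] by (auto intro: card_ge_0_finite)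
  have "\<exists>U. subgroup U (add_monoid K) \<and> card U = p ^ k" if "m + n = k + k'" for k k'
    using that by (intro sylow_thm [OF p add.is_group _ fin, of _ "p ^ k'"]) (simp add: order_def K power_add)
  then obtain U V where "subgroup U (add_monoid K)" "card U = p ^ m"
    "subgroup V (add_monoid K)" "card V = p ^ n"
    by (metis add.commute)
  then have "sudoku_field K U V (p ^ m) (p ^ n)"
    using K pos
    by (intro sudoku_field.intro sudoku_field_axioms.intro additive_subgroup.intro) (simp_all add: power_add)
  then show ?thesis
    by blast
qed

theorem theorem4p3:
  fixes p m n q r l :: nat
  assumes "prime p" and "m > 0" and "n > 0"
    and "q = p ^ m" and "r = p ^ n"
    and "l = max (p ^ m * (p - 1)) (p ^ n * (p - 1))"
  shows "\<exists>L :: nat \<Rightarrow> nat mat.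
    (\<forall>k\<in>{1..l}. sudoku_latin_square q r (L k) \<and> block_permutational q r (L k)) \<and>
    (\<forall>k\<in>{1..l}. \<forall>k'\<in>{1..l}. k \<noteq> k' \<longrightarrow> orthogonal_squares (q * r) (L k) (L k'))"
proof -
  obtain K :: "((int list \<times> nat) multiset \<Rightarrow> int) ring" and U V where "sudoku_field K U V q r"
    using exists_sudoku_field assms by blast
  then interpret sudoku_field K U V q r .
  obtain S where S: "\<And>c. c \<in> scalars \<Longrightarrow> sudoku_latin_square q r (S c) \<and> block_permutational q r (S c)"
    "\<And>c d. c \<in> scalars \<Longrightarrow> d \<in> scalars \<Longrightarrow> c \<noteq> d \<Longrightarrow> orthogonal_squares (q * r) (S c) (S d)"
    using exists_squares by blast
  \<comment> \<open>By this count \<open>{1..l}\<close> embeds into the scalars; distinct indices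
    get distinct scalars and hence orthogonal squares.\<close>
  have "card {1..l} \<le> card scalars"
    using card_scalars_ge assms by simp
  moreover have "finite scalars"
    using finite_carrier by (simp add: scalars_def)
  ultimately obtain g where "g ` {1..l} \<subseteq> scalars" "inj_on g {1..l}"
    using card_le_inj [of "{1..l}" scalars] by auto
  then show ?thesis
    using S by (intro exI [of _ "S \<circ> g"]) (auto simp: image_subset_iff inj_on_eq_iff)
qed

end
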